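(* Let $G$ be a group and let $X$ be a finite generating set of $G$. If $G$ is graph automatic with respect to $X$, then $G$ is graph automatic with respect to every finite generating set $Y$ of $G$.
   Context: For a finite alphabet $\Sigma$, let $\Sigma^\star$ be the set of finite strings over $\Sigma$. For strings $w_1,\dots,w_n\in\Sigma^\star$ the convolution $\otimes(w_1,\dots,w_n)$ is the string of length $\max_i|w_i|$ over the alphabet $(\Sigma\cup\{\diamond\})^n$ (with $\diamond\notin\Sigma$) whose $k$-th symbol is $(\sigma_1,\dots,\sigma_n)$, where $\sigma_i$ is the $k$-th symbol of $w_i$ if $k\le|w_i|$ and $\sigma_i=\diamond$ otherwise. A relation $R\subseteq(\Sigma^\star)^n$ is FA recognizable if $\{\otimes(w_1,\dots,w_n)\mid (w_1,\dots,w_n)\in R\}$ is a regular language (recognized by a finite automaton). Let $G$ be a group generated by a finite set $X$. Its Cayley graph $\Gamma(G,X)$ is viewed as the structure $(G;(E_x)_{x\in X})$ with $E_x=\{(g,gx)\mid g\in G\}$. The group $G$ is graph automatic with respect to $X$ if there are a finite alphabet $\Sigma$, a regular language $R\subseteq\Sigma^\star$ and a bijection $\nu:R\to G$ such that for each $x\in X$ the relation $\{(u,v)\in R^2\mid \nu(u)x=\nu(v)\}$ is FA recognizable. *)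

theory Defs
  imports "HOL-Algebra.Generated_Groups"
begin

record ('q, 'a) automaton =
  states :: "'q set"
  init   :: 'q
  transitions :: "('q \<times> 'a \<times> 'q) set"
  final  :: "'q set"

definition finite_automaton :: "'a set \<Rightarrow> ('q, 'a) automaton \<Rightarrow> bool" where
  "finite_automaton A M \<longleftrightarrow>
     finite (states M) \<and> init M \<in> states M \<and> final M \<subseteq> states M \<and>
     transitions M \<subseteq> states M \<times> A \<times> states M"

inductive run :: "('q, 'a) automaton \<Rightarrow> 'q \<Rightarrow> 'a list \<Rightarrow> 'q \<Rightarrow> bool" for M where
  run_Nil: "run M p [] p"
| run_Cons: "(p, a, q) \<in> transitions M \<Longrightarrow> run M q w r \<Longrightarrow> run M p (a # w) r"

definition language :: "('q, 'a) automaton \<Rightarrow> 'a list set" where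
  "language M = {w. \<exists>q \<in> final M. run M (init M) w q}"

text \<open>HOL cannot quantify existentially over types.  The states are natural numbers, which is
  no restriction because the state set is finite.\<close>

definition regular :: "'a set \<Rightarrow> 'a list set \<Rightarrow> bool" where
  "regular A L \<longleftrightarrow> (\<exists>M :: (nat, 'a) automaton. finite_automaton A M \<and> language M = L)"

text \<open>An n-tuple of strings is a list of length n.  A symbol of the n-fold padded alphabet is a
  list of length n over \<^typ>\<open>'a option\<close>, where \<^const>\<open>None\<close> is the padding
  symbol.  The inserted 0 only matters for the empty tuple, where \<^const>\<open>Max\<close> would
  otherwise be unspecified.\<close>

definition padded_alphabet :: "'a set \<Rightarrow> nat \<Rightarrow> 'a option list set" where
  "padded_alphabet \<Sigma> n = {s. length s = n \<and> set s \<subseteq> insert None (Some ` \<Sigma>)}"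

definition convolution :: "'a list list \<Rightarrow> 'a option list list" where
  "convolution ws =
     map (\<lambda>k. map (\<lambda>w. if k < length w then Some (w ! k) else None) ws)
       [0..<Max (insert 0 (length ` set ws))]"

definition FA_recognizable :: "'a set \<Rightarrow> nat \<Rightarrow> 'a list list set \<Rightarrow> bool" where
  "FA_recognizable \<Sigma> n R \<longleftrightarrow>
     R \<subseteq> {ws. length ws = n \<and> set ws \<subseteq> lists \<Sigma>} \<and>
     regular (padded_alphabet \<Sigma> n) (convolution ` R)"

definition finite_generating_set :: "('g, 'b) monoid_scheme \<Rightarrow> 'g set \<Rightarrow> bool" where
  "finite_generating_set G X \<longleftrightarrow>
     finite X \<and> X \<subseteq> carrier G \<and> generate G X = carrier G"

text \<open>Alphabets are finite sets of natural numbers, which up to renaming of symbols covers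
  every finite alphabet.\<close>

definition graph_automatic :: "('g, 'b) monoid_scheme \<Rightarrow> 'g set \<Rightarrow> bool" where
  "graph_automatic G X \<longleftrightarrow>
     (\<exists>(\<Sigma> :: nat set) R \<nu>.
        finite \<Sigma> \<and> regular \<Sigma> R \<and> bij_betw \<nu> R (carrier G) \<and>
        (\<forall>x \<in> X. FA_recognizable \<Sigma> 2
           {[u, v] | u v. u \<in> R \<and> v \<in> R \<and> \<nu> u \<otimes>\<^bsub>G\<^esub> x = \<nu> v}))"

end

theory Submission imports Defs begin

text \<open>Write \<open>E g\<close> for the relation \<open>\<nu> u \<otimes> g = \<nu> v\<close> on \<open>R\<close>.  Then \<open>E \<one>\<close> is the diagonal of \<open>R\<close>,
  \<open>E (inv g)\<close> is the converse of \<open>E g\<close>, and, because \<open>\<nu>\<close> is onto, \<open>E (g \<otimes> h)\<close> is the composition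
  of \<open>E g\<close> with \<open>E h\<close>.  Binary FA recognizable relations are closed under these operations, so
  \<open>E g\<close> is recognizable for all \<open>g\<close> in the group generated by \<open>X\<close>.  For the composition, the
  intermediate string may be longer or shorter than the outer two; one therefore passes to
  convolutions followed by arbitrarily many blank columns, projects, and removes the blank columns
  again.\<close>

section \<open>Closure properties of regular languages\<close>

lemma run_Nil_iff [simp]: "run M p [] q \<longleftrightarrow> p = q"
  by (subst run.simps) auto

lemma run_Cons_iff [simp]:
  "run M p (a # w) r \<longleftrightarrow> (\<exists>q. (p, a, q) \<in> transitions M \<and> run M q w r)"
  by (subst run.simps) auto

lemma run_append: "run M p (v @ w) r \<longleftrightarrow> (\<exists>q. run M p v q \<and> run M q w r)"
  by (induction v arbitrary: p) auto

lemma run_cong: "transitions M = transitions N \<Longrightarrow> run M p w q \<longleftrightarrow> run N p w q"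
  by (induction w arbitrary: p) auto

lemma run_in_states:
  assumes "finite_automaton A M" "run M p w q" "p \<in> states M"
  shows "q \<in> states M" "w \<in> lists A"
  using assms(2,3,1) by (induction rule: run.induct) (auto simp: finite_automaton_def)

text \<open>The finite state set injects into the natural numbers, and the automaton is transported
  along the injection. This lets later constructions use pairs or options as states although
  \<open>regular\<close> asks for states of type \<open>nat\<close>.\<close>

lemma regular_language:
  fixes M :: "('q, 'a) automaton"
  assumes M: "finite_automaton A M"
  shows "regular A (language M)"
proof -
  have "finite (states M)" using M by (simp add: finite_automaton_def)
  then obtain f :: "'q \<Rightarrow> nat" where f: "inj_on f (states M)"
    using finite_imp_inj_to_nat_seg by blast
  define N where "N = \<lparr>states = f ` states M, init = f (init M),
    transitions = (\<lambda>(p, a, q). (f p, a, f q)) ` transitions M, final = f ` final M\<rparr>"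
  have N: "finite_automaton A N"
    using M by (auto simp: finite_automaton_def N_def)
  have step: "(f p, a, y) \<in> transitions N \<longleftrightarrow> (\<exists>q. y = f q \<and> (p, a, q) \<in> transitions M)"
    if "p \<in> states M" for p a y
  proof
    assume "(f p, a, y) \<in> transitions N"
    then obtain p' q where "f p = f p'" "y = f q" "(p', a, q) \<in> transitions M"
      by (auto simp: N_def)
    moreover from this(3) have "p' \<in> states M" using M by (auto simp: finite_automaton_def)
    ultimately show "\<exists>q. y = f q \<and> (p, a, q) \<in> transitions M"
      using f that by (auto dest: inj_onD)
  qed (force simp: N_def)
  have st: "q \<in> states M" if "(p, a, q) \<in> transitions M" for p a q
    using that M by (auto simp: finite_automaton_def)
  have run: "run N (f p) w y \<longleftrightarrow> (\<exists>q. y = f q \<and> run M p w q)" if "p \<in> states M" for p w y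
    using that
  proof (induction w arbitrary: p)
    case (Cons a w)
    then show ?case using st by (auto simp: step) blast+
  qed auto
  have init: "init M \<in> states M" and fin: "final M \<subseteq> states M"
    using M by (auto simp: finite_automaton_def)
  have "w \<in> language N \<longleftrightarrow> w \<in> language M" for w
  proof
    assume "w \<in> language N"
    then obtain q' where q': "q' \<in> final M" "run N (f (init M)) w (f q')"
      by (auto simp: language_def N_def)
    from run[OF init] q'(2) obtain q where q: "f q' = f q" "run M (init M) w q"
      by blast
    \<comment> \<open>The renaming \<open>f\<close> is injective only on \<open>states M\<close>, so
      both \<open>q\<close> and \<open>q'\<close> must first be known to be states.\<close>
    have "q' = q"
      using q(1) q'(1) fin run_in_states(1)[OF M q(2) init] by (auto dest: inj_onD[OF f])
    with q q' show "w \<in> language M" by (auto simp: language_def)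
  next
    assume "w \<in> language M"
    then obtain q where "q \<in> final M" "run M (init M) w q"
      by (auto simp: language_def)
    moreover from this(2) run[OF init] have "run N (f (init M)) w (f q)" by blast
    ultimately show "w \<in> language N" by (auto simp: language_def N_def)
  qed
  then have "language N = language M" by blast
  with N show ?thesis unfolding regular_def by blast
qed

lemma regular_subset_lists: "regular A L \<Longrightarrow> L \<subseteq> lists A"
  unfolding regular_def language_def
  by (auto simp: finite_automaton_def dest!: run_in_states(2)[rotated])

section \<open>Letterwise relations and intersections\<close>

text \<open>Each transition label \<open>a\<close> is replaced by all letters of \<open>B\<close>
  related to it, so that the automaton guesses \<open>v\<close> while reading \<open>w\<close>.
  Suitable choices of \<open>r\<close> give changes of alphabet, images and preimages under letter
  maps.\<close>

lemma regular_letter_relation: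
  assumes "regular A L"
  shows "regular B {w \<in> lists B. \<exists>v\<in>L. list_all2 r w v}"
proof -
  obtain M :: "(nat, 'a) automaton" where M: "finite_automaton A M" and L: "language M = L"
    using assms by (auto simp: regular_def)
  define N where "N = \<lparr>states = states M, init = init M,
    transitions = {(p, b, q). b \<in> B \<and> (\<exists>a. r b a \<and> (p, a, q) \<in> transitions M)},
    final = final M\<rparr>"
  have N: "finite_automaton B N"
    using M by (auto simp: finite_automaton_def N_def)
  have "run N p w q \<longleftrightarrow> w \<in> lists B \<and> (\<exists>v. list_all2 r w v \<and> run M p v q)" for p w q
  proof (induction w arbitrary: p)
    case (Cons b w)
    have "(p, b, s) \<in> transitions N \<longleftrightarrow> b \<in> B \<and> (\<exists>a. r b a \<and> (p, a, s) \<in> transitions M)" for s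
      by (simp add: N_def)
    then have "run N p (b # w) q \<longleftrightarrow>
        b \<in> B \<and> w \<in> lists B \<and> (\<exists>a v. r b a \<and> list_all2 r w v \<and> run M p (a # v) q)"
      unfolding run_Cons_iff Cons.IH by blast
    also have "\<dots> \<longleftrightarrow> b # w \<in> lists B \<and> (\<exists>v. list_all2 r (b # w) v \<and> run M p v q)"
      unfolding list_all2_Cons1 Cons_in_lists_iff by blast
    finally show ?case .
  qed auto
  then have "language N = {w \<in> lists B. \<exists>v\<in>L. list_all2 r w v}"
    by (auto simp: language_def L[symmetric]) (auto simp: N_def)
  with regular_language[OF N] show ?thesis by simp
qed

lemma regular_Int_lists: "regular A L \<Longrightarrow> regular B (L \<inter> lists B)"
  using regular_letter_relation[of A L B "(=)"] 
  by (simp add: list.rel_eq Int_def conj_commute)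

lemma regular_map_image:
  assumes "regular A L" "f ` A \<subseteq> B"
  shows "regular B (map f ` L)"
proof -
  have "list_all2 (\<lambda>b a. b = f a) w v \<longleftrightarrow> w = map f v" for w v
    by (auto simp: list_all2_conv_all_nth list_eq_iff_nth_eq)
  moreover have "map f v \<in> lists B" if "v \<in> L" for v
    using regular_subset_lists[OF assms(1)] assms(2) that by (fastforce simp: in_lists_conv_set)
  ultimately have "{w \<in> lists B. \<exists>v\<in>L. list_all2 (\<lambda>b a. b = f a) w v} = map f ` L"
    by blast
  then show ?thesis using regular_letter_relation[OF assms(1), of B "\<lambda>b a. b = f a"] by simp
qed

lemma regular_map_vimage:
  assumes "regular A L"
  shows "regular B {w \<in> lists B. map f w \<in> L}"
proof -
  have "list_all2 (\<lambda>b a. f b = a) w v \<longleftrightarrow> map f w = v" for w v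
    by (auto simp: list_all2_conv_all_nth list_eq_iff_nth_eq)
  then show ?thesis
    using regular_letter_relation[OF assms, of B "\<lambda>b a. f b = a"] by simp
qed

lemma regular_Int:
  assumes "regular A K" "regular A L"
  shows "regular A (K \<inter> L)"
proof -
  obtain M N :: "(nat, 'a) automaton" where M: "finite_automaton A M" "language M = K"
    and N: "finite_automaton A N" "language N = L"
    using assms by (auto simp: regular_def)
  define P where "P = \<lparr>states = states M \<times> states N, init = (init M, init N),
    transitions = {((p, p'), a, (q, q')) | p p' a q q'.
      (p, a, q) \<in> transitions M \<and> (p', a, q') \<in> transitions N},
    final = final M \<times> final N\<rparr>"
  have P: "finite_automaton A P"
    using M N by (auto simp: finite_automaton_def P_def)
  have "run P (p, p') w (q, q') \<longleftrightarrow> run M p w q \<and> run N p' w q'" for p p' w q q'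
  proof (induction w arbitrary: p p')
    case (Cons a w)
    have "run P (p, p') (a # w) (q, q') \<longleftrightarrow> (\<exists>s s'. (p, a, s) \<in> transitions M \<and>
        (p', a, s') \<in> transitions N \<and> run P (s, s') w (q, q'))"
      by (auto simp: P_def)
    with Cons.IH show ?case by auto
  qed auto
  then have "language P = K \<inter> L"
    by (auto simp: language_def M(2)[symmetric] N(2)[symmetric] P_def)
  with regular_language[OF P] show ?thesis by simp
qed

section \<open>Adding and removing trailing copies of a letter\<close>

text \<open>A new accepting state \<open>None\<close>, entered from accepting states by reading
  \<open>z\<close> and looping on \<open>z\<close>, absorbs the tail. The old accepting states stay
  accepting, which covers \<open>k = 0\<close>.\<close>

lemma regular_append_replicate:
  assumes "regular A L" "z \<in> A"
  shows "regular A {v @ replicate k z | v k. v \<in> L}"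
proof -
  obtain M :: "(nat, 'a) automaton" where M: "finite_automaton A M" and L: "language M = L"
    using assms by (auto simp: regular_def)
  define N where "N = \<lparr>states = insert None (Some ` states M), init = Some (init M),
    transitions = {(Some p, a, Some q) | p a q. (p, a, q) \<in> transitions M} \<union>
      {(Some p, z, None) | p. p \<in> final M} \<union> {(None, z, None)},
    final = insert None (Some ` final M)\<rparr>"
  have N: "finite_automaton A N"
    using M \<open>z \<in> A\<close> by (auto simp: finite_automaton_def N_def)
  have trans_Some: "(Some p, a, t) \<in> transitions N \<longleftrightarrow>
      (\<exists>s. t = Some s \<and> (p, a, s) \<in> transitions M) \<or> a = z \<and> p \<in> final M \<and> t = None" for p a t
    by (auto simp: N_def)
  have trans_None: "(None, a, t) \<in> transitions N \<longleftrightarrow> a = z \<and> t = None" for a t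
    by (auto simp: N_def)
  have final: "t \<in> final N \<longleftrightarrow> t = None \<or> (\<exists>q. t = Some q \<and> q \<in> final M)" for t
    by (auto simp: N_def)
  have None: "run N None w t \<longleftrightarrow> t = None \<and> w = replicate (length w) z" for w t
  proof (induction w)
    case (Cons a w)
    have "run N None (a # w) t \<longleftrightarrow> a = z \<and> run N None w t" by (simp add: trans_None)
    with Cons.IH show ?case by auto
  qed auto
  have Some: "(\<exists>t\<in>final N. run N (Some p) w t) \<longleftrightarrow>
      (\<exists>v k q. w = v @ replicate k z \<and> q \<in> final M \<and> run M p v q)" for p w
  proof (induction w arbitrary: p)
    case Nil
    then show ?case by (auto simp: final)
  next
    case (Cons a w)
    have "(\<exists>t\<in>final N. run N (Some p) (a # w) t) \<longleftrightarrow>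
        (\<exists>s. (p, a, s) \<in> transitions M \<and> (\<exists>t\<in>final N. run N (Some s) w t)) \<or>
        (a = z \<and> p \<in> final M \<and> (\<exists>t\<in>final N. run N None w t))"
      unfolding run_Cons_iff trans_Some by blast
    also have "\<dots> \<longleftrightarrow> (\<exists>s v k q. (p, a, s) \<in> transitions M \<and>
          w = v @ replicate k z \<and> q \<in> final M \<and> run M s v q) \<or>
        (p \<in> final M \<and> (\<exists>k. a # w = replicate (Suc k) z))"
    proof -
      have "(\<exists>t\<in>final N. run N None w t) \<longleftrightarrow> (\<exists>k. w = replicate k z)"
        by (auto simp: None final)
      then show ?thesis unfolding Cons.IH by auto
    qed
    \<comment> \<open>The two alternatives correspond to nonempty and empty \<open>v\<close>. For
      empty \<open>v\<close> the letter \<open>a\<close> is itself the first \<open>z\<close> of the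
      tail, hence \<open>Suc k\<close>.\<close>
    also have "\<dots> \<longleftrightarrow>
      (\<exists>v k q. a # w = v @ replicate k z \<and> q \<in> final M \<and> run M p v q)" (is "?l \<longleftrightarrow> ?r")
    proof
      assume ?l
      then show ?r
      proof (elim disjE exE conjE)
        fix s v k q
        assume "(p, a, s) \<in> transitions M" "w = v @ replicate k z" "q \<in> final M" "run M s v q"
        then show ?r by (intro exI[of _ "a # v"] exI[of _ k] exI[of _ q]) auto
      next
        fix k assume "p \<in> final M" "a # w = replicate (Suc k) z"
        then show ?r by (intro exI[of _ "[]"] exI[of _ "Suc k"] exI[of _ p]) auto
      qed
    next
      assume ?r
      then obtain v k q where *: "a # w = v @ replicate k z" "q \<in> final M" "run M p v q"
        by blast
      show ?l
      proof (cases v)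
        case Nil
        with * show ?thesis by (cases k) auto
      next
        case (Cons b u)
        with * show ?thesis by auto
      qed
    qed
    finally show ?case .
  qed
  have "language N = {v @ replicate k z | v k. v \<in> L}"
  proof (rule Set.set_eqI)
    fix w
    have "w \<in> language N \<longleftrightarrow> (\<exists>t\<in>final N. run N (Some (init M)) w t)"
      by (simp add: language_def N_def)
    also have "\<dots> \<longleftrightarrow> w \<in> {v @ replicate k z | v k. v \<in> L}"
      unfolding Some by (auto simp: language_def L[symmetric])
    finally show "w \<in> language N \<longleftrightarrow> w \<in> {v @ replicate k z | v k. v \<in> L}" .
  qed
  with regular_language[OF N] show ?thesis by simp
qed

text \<open>The transitions are kept, and a state becomes accepting as soon as some block of letters
  \<open>z\<close> leads from it to an accepting state of \<open>M\<close>.\<close>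

lemma regular_quotient_replicate:
  assumes "regular A L"
  shows "regular A {v. \<exists>k. v @ replicate k z \<in> L}"
proof -
  obtain M :: "(nat, 'a) automaton" where M: "finite_automaton A M" and L: "language M = L"
    using assms by (auto simp: regular_def)
  define N where "N = M\<lparr>final :=
    {p \<in> states M. \<exists>k. \<exists>q\<in>final M. run M p (replicate k z) q}\<rparr>"
  have N: "finite_automaton A N"
    using M by (auto simp: finite_automaton_def N_def)
  have run: "run N p w q \<longleftrightarrow> run M p w q" for p w q
    by (rule run_cong) (simp add: N_def)
  \<comment> \<open>An accepting run on \<open>v @ replicate k z\<close> is split at the state
    reached after \<open>v\<close>; that this is a state of \<open>M\<close> is required for
    membership in the new final set.\<close>
  have "language N = {v. \<exists>k. v @ replicate k z \<in> L}"
    using run_in_states(1)[OF M] M unfolding finite_automaton_def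
    by (auto simp: language_def run L[symmetric] run_append) (auto simp: N_def)
  with regular_language[OF N] show ?thesis by simp
qed

section \<open>Binary FA recognizable relations\<close>

definition letter_at :: "'a list \<Rightarrow> nat \<Rightarrow> 'a option" where
  "letter_at w k = (if k < length w then Some (w ! k) else None)"

text \<open>For \<open>n\<close> at least both lengths this is the convolution followed by blank
  columns. Keeping \<open>n\<close> free lets pairs taken from three strings share one
  length.\<close>

definition padded_pair :: "nat \<Rightarrow> 'a list \<Rightarrow> 'a list \<Rightarrow> 'a option list list" where
  "padded_pair n u v = map (\<lambda>k. [letter_at u k, letter_at v k]) [0..<n]"

lemma convolution_pair: "convolution [u, v] = padded_pair (max (length u) (length v)) u v"
  by (simp add: convolution_def padded_pair_def letter_at_def)

text \<open>Since \<open>n\<close> reaches the end of the string, deleting the entries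
  \<open>None\<close> from the padded sequence recovers it.\<close>

lemma letter_at_inject:
  assumes "length u \<le> n" "length v \<le> n"
    and eq: "map (letter_at u) [0..<n] = map (letter_at v) [0..<n]"
  shows "u = v"
proof -
  have "map the (filter (\<lambda>x. x \<noteq> None) (map (letter_at w) [0..<n])) = w" if "length w \<le> n" for w
  proof -
    have "map (letter_at w) [0..<n] = map Some w @ replicate (n - length w) None"
      using that by (intro nth_equalityI) (auto simp: letter_at_def nth_append)
    then show ?thesis by (simp add: filter_map o_def)
  qed
  with assms show ?thesis by metis
qed

lemma padded_pair_append_blank:
  assumes "length u \<le> n" "length v \<le> n"
  shows "padded_pair n u v @ replicate k [None, None] = padded_pair (n + k) u v"
  using assms
  by (intro nth_equalityI) (auto simp: padded_pair_def nth_append letter_at_def)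

text \<open>A column before the end of the longer string contains a letter, and every later column
  is blank. So exactly one way of cutting off trailing blanks leaves no blank column, and what it
  leaves is the convolution.\<close>

lemma padded_pair_decompose:
  assumes "length u \<le> n" "length v \<le> n"
  shows "s @ replicate k [None, None] = padded_pair n u v \<and> [None, None] \<notin> set s \<longleftrightarrow>
    s = convolution [u, v] \<and> n = length s + k"
proof
  let ?l = "max (length u) (length v)"
  assume *: "s @ replicate k [None, None] = padded_pair n u v \<and> [None, None] \<notin> set s"
  have len: "length s + k = n"
    using arg_cong[OF conjunct1[OF *], of length] by (simp add: padded_pair_def)
  have nth: "(s @ replicate k [None, None]) ! i = [letter_at u i, letter_at v i]" if "i < n" for i
    using * that by (simp add: padded_pair_def)
  \<comment> \<open>Otherwise the first blank cut off would stand at a position where one of the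
    strings still has a letter.\<close>
  have "\<not> length s < ?l"
  proof
    assume "length s < ?l"
    with assms len have "letter_at u (length s) = None" "letter_at v (length s) = None"
      using nth[of "length s"] by (auto simp: nth_append)
    with \<open>length s < ?l\<close> show False
      by (auto simp: letter_at_def split: if_splits)
  qed
  \<comment> \<open>Otherwise column \<open>?l\<close>, which lies beyond both strings and is blank,
    would belong to \<open>s\<close>.\<close>
  moreover have "\<not> ?l < length s"
  proof
    assume "?l < length s"
    then have "s ! ?l = [letter_at u ?l, letter_at v ?l]"
      using nth[of ?l] len by (simp add: nth_append)
    also have "\<dots> = [None, None]" by (simp add: letter_at_def)
    finally have "s ! ?l = [None, None]" .
    with \<open>?l < length s\<close> * show False by (metis nth_mem)
  qed
  ultimately have l: "length s = ?l" by linarith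
  have "s = convolution [u, v]"
    unfolding convolution_pair
  proof (rule nth_equalityI)
    fix i assume "i < length s"
    then show "s ! i = padded_pair ?l u v ! i"
      using nth[of i] len l by (simp add: nth_append padded_pair_def)
  qed (simp add: l padded_pair_def)
  with len show "s = convolution [u, v] \<and> n = length s + k" by simp
next
  assume *: "s = convolution [u, v] \<and> n = length s + k"
  then have "n = max (length u) (length v) + k" by (simp add: convolution_pair padded_pair_def)
  moreover have "[None, None] \<notin> set s"
    using * by (auto simp: convolution_pair padded_pair_def letter_at_def split: if_splits)
  ultimately show "s @ replicate k [None, None] = padded_pair n u v \<and> [None, None] \<notin> set s"
    by (simp add: conjunct1[OF *] convolution_pair padded_pair_append_blank)
qed

section \<open>Diagonal, converse and composition of recognizable relations\<close>

lemma blank_in_padded_alphabet: "[None, None] \<in> padded_alphabet \<Sigma> 2"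
  by (simp add: padded_alphabet_def)

text \<open>Equal strings need no padding, so the convolution of \<open>u\<close> with itself is the
  image of \<open>u\<close> under a letter map.\<close>

lemma FA_recognizable_diagonal:
  assumes "regular \<Sigma> R"
  shows "FA_recognizable \<Sigma> 2 {[u, u] | u. u \<in> R}"
proof -
  have "convolution [u, u] = map (\<lambda>a. [Some a, Some a]) u" for u :: "'a list"
    by (intro nth_equalityI) (auto simp: convolution_pair padded_pair_def letter_at_def)
  then have "convolution ` {[u, u] | u. u \<in> R} = map (\<lambda>a. [Some a, Some a]) ` R"
    by (simp add: setcompr_eq_image image_image)
  moreover have "regular (padded_alphabet \<Sigma> 2) (map (\<lambda>a. [Some a, Some a]) ` R)"
    by (rule regular_map_image[OF assms]) (auto simp: padded_alphabet_def)
  ultimately show ?thesis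
    using regular_subset_lists[OF assms] by (auto simp: FA_recognizable_def)
qed

lemma FA_recognizable_pair_letters:
  assumes "FA_recognizable \<Sigma> 2 {[u, v] | u v. P u v}" "P u v"
  shows "set u \<subseteq> \<Sigma>" "set v \<subseteq> \<Sigma>"
proof -
  have "[u, v] \<in> {ws. length ws = 2 \<and> set ws \<subseteq> lists \<Sigma>}"
    using assms unfolding FA_recognizable_def by blast
  then show "set u \<subseteq> \<Sigma>" "set v \<subseteq> \<Sigma>" by auto
qed

text \<open>Swapping the two strings reverses every column of the convolution and keeps its length,
  so it acts as a letter map.\<close>

lemma FA_recognizable_converse:
  assumes "FA_recognizable \<Sigma> 2 {[u, v] | u v. P u v}"
  shows "FA_recognizable \<Sigma> 2 {[u, v] | u v. P v u}"
proof -
  have rev: "convolution (rev ws) = map rev (convolution ws)" for ws :: "'a list list"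
    by (simp add: convolution_def rev_map)
  have "{[u, v] | u v. P v u} = rev ` {[u, v] | u v. P u v}"
    by (force simp: image_def)
  then have "convolution ` {[u, v] | u v. P v u} =
      map rev ` convolution ` {[u, v] | u v. P u v}"
    by (simp only: image_image rev)
  moreover have "regular (padded_alphabet \<Sigma> 2) (map rev ` convolution ` {[u, v] | u v. P u v})"
    using assms unfolding FA_recognizable_def
    by (intro regular_map_image[where A = "padded_alphabet \<Sigma> 2"]) (auto simp: padded_alphabet_def)
  moreover have "{[u, v] | u v. P v u} \<subseteq> {ws. length ws = 2 \<and> set ws \<subseteq> lists \<Sigma>}"
    using FA_recognizable_pair_letters[OF assms] by (fastforce dest: subsetD)
  ultimately show ?thesis by (simp add: FA_recognizable_def)
qed

lemma FA_recognizable_padded: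
  assumes "FA_recognizable \<Sigma> 2 {[u, v] | u v. P u v}"
  shows "regular (padded_alphabet \<Sigma> 2)
    {padded_pair n u v | n u v. P u v \<and> length u \<le> n \<and> length v \<le> n}"
proof -
  let ?L = "convolution ` {[u, v] | u v. P u v}"
  have "regular (padded_alphabet \<Sigma> 2) {s @ replicate k [None, None] | s k. s \<in> ?L}"
    using assms by (intro regular_append_replicate blank_in_padded_alphabet)
      (simp add: FA_recognizable_def)
  also have "{s @ replicate k [None, None] | s k. s \<in> ?L} =
      {padded_pair n u v | n u v. P u v \<and> length u \<le> n \<and> length v \<le> n}" (is "?S = ?T")
  proof
    show "?S \<subseteq> ?T"
      by (auto simp: convolution_pair padded_pair_append_blank)
        (metis le_add1 max.cobounded1 max.cobounded2 order_trans)
    show "?T \<subseteq> ?S"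
    proof
      fix x assume "x \<in> ?T"
      then obtain n u v where *: "x = padded_pair n u v" "P u v" "length u \<le> n" "length v \<le> n"
        by blast
      let ?l = "max (length u) (length v)"
      have "x = convolution [u, v] @ replicate (n - ?l) [None, None]"
        using * by (simp add: convolution_pair padded_pair_append_blank)
      with *(2) show "x \<in> ?S" by blast
    qed
  qed
  finally show ?thesis .
qed

text \<open>Words over triples carry \<open>u\<close>, \<open>w\<close>, \<open>v\<close> on three
  tracks, in this order. \<open>K1\<close> checks \<open>P\<close> on the first two tracks,
  \<open>K2\<close> checks \<open>Q\<close> on the last two, and \<open>J\<close> forgets the middle
  one.\<close>

lemma FA_recognizable_relcomp:
  assumes P: "FA_recognizable \<Sigma> 2 {[u, v] | u v. P u v}"
    and Q: "FA_recognizable \<Sigma> 2 {[u, v] | u v. Q u v}"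
  shows "FA_recognizable \<Sigma> 2 {[u, v] | u v. \<exists>w. P u w \<and> Q w v}"
proof -
  define B where "B = insert None (Some ` \<Sigma>)"
  define K1 where "K1 = {t \<in> lists (B \<times> B \<times> B). map (\<lambda>(a, c, b). [a, c]) t \<in>
    {padded_pair n u v | n u v. P u v \<and> length u \<le> n \<and> length v \<le> n}}"
  define K2 where "K2 = {t \<in> lists (B \<times> B \<times> B). map (\<lambda>(a, c, b). [c, b]) t \<in>
    {padded_pair n u v | n u v. Q u v \<and> length u \<le> n \<and> length v \<le> n}}"
  define J where "J = map (\<lambda>(a, c, b). [a, b]) ` (K1 \<inter> K2)"
  have PS: "set u \<subseteq> \<Sigma>" "set v \<subseteq> \<Sigma>" if "P u v" for u v
    using FA_recognizable_pair_letters[OF P that] .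
  have QS: "set u \<subseteq> \<Sigma>" "set v \<subseteq> \<Sigma>" if "Q u v" for u v
    using FA_recognizable_pair_letters[OF Q that] .
  have "regular (B \<times> B \<times> B) K1" "regular (B \<times> B \<times> B) K2"
    unfolding K1_def K2_def
    by (rule regular_map_vimage, rule FA_recognizable_padded, fact)+
  then have "regular (padded_alphabet \<Sigma> 2) J"
    unfolding J_def
    by (intro regular_map_image[OF regular_Int]) (auto simp: padded_alphabet_def B_def)
  then have "regular (padded_alphabet \<Sigma> 2) {s. \<exists>k. s @ replicate k [None, None] \<in> J}" (is "regular _ ?D")
    by (rule regular_quotient_replicate)
  \<comment> \<open>The quotient still contains words from which only some of the trailing blanks
    were removed. Excluding the blank column as a letter leaves just the convolutions.\<close>
  then have "regular (padded_alphabet \<Sigma> 2 - {[None, None]})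
      (?D \<inter> lists (padded_alphabet \<Sigma> 2 - {[None, None]}))"
    by (rule regular_Int_lists)
  \<comment> \<open>Every word in question is already over the larger alphabet; intersecting again
    only changes the alphabet of the automaton.\<close>
  then have reg: "regular (padded_alphabet \<Sigma> 2)
      ((?D \<inter> lists (padded_alphabet \<Sigma> 2 - {[None, None]})) \<inter> lists (padded_alphabet \<Sigma> 2))"
    by (rule regular_Int_lists)
  have at: "letter_at w k \<in> B" if "set w \<subseteq> \<Sigma>" for w k
    using that nth_mem[of k w] by (auto simp: letter_at_def B_def subset_iff)
  have J: "J = {padded_pair n u v | n u v. \<exists>w. P u w \<and> Q w v \<and>
      length u \<le> n \<and> length w \<le> n \<and> length v \<le> n}" (is "_ = ?J")
  proof
    show "J \<subseteq> ?J"
    proof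
      fix s assume "s \<in> J"
      then obtain t n u w n' w' v where s: "s = map (\<lambda>(a, c, b). [a, b]) t"
        and 1: "map (\<lambda>(a, c, b). [a, c]) t = padded_pair n u w" "P u w" "length u \<le> n" "length w \<le> n"
        and 2: "map (\<lambda>(a, c, b). [c, b]) t = padded_pair n' w' v" "Q w' v" "length w' \<le> n'" "length v \<le> n'"
        unfolding J_def K1_def K2_def by blast
      have n: "length t = n" "n' = n"
        using arg_cong[OF 1(1), of length] arg_cong[OF 2(1), of length]
        by (simp_all add: padded_pair_def)
      have t: "t ! k = (letter_at u k, letter_at w k, letter_at v k) \<and> letter_at w' k = letter_at w k"
        if "k < n" for k
        using arg_cong[OF 1(1), of "\<lambda>x. x ! k"] arg_cong[OF 2(1), of "\<lambda>x. x ! k"] that n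
        by (auto simp: padded_pair_def split: prod.splits)
      \<comment> \<open>\<open>P\<close> and \<open>Q\<close> may read the middle track as different
        strings; both end within \<open>n\<close>, so the common track forces them to agree.\<close>
      have "w' = w"
        by (rule letter_at_inject[of _ n]) (use 1 2 n t in auto)
      moreover have "s = padded_pair n u v"
        by (rule nth_equalityI) (use n t in \<open>auto simp: s padded_pair_def\<close>)
      ultimately show "s \<in> ?J" using 1 2 n by blast
    qed
    show "?J \<subseteq> J"
    proof
      fix s assume "s \<in> ?J"
      then obtain n u v w where *: "s = padded_pair n u v" "P u w" "Q w v"
        "length u \<le> n" "length w \<le> n" "length v \<le> n" by blast
      define t where "t = map (\<lambda>k. (letter_at u k, letter_at w k, letter_at v k)) [0..<n]"
      have "t \<in> lists (B \<times> B \<times> B)"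
        using at PS[OF *(2)] QS(2)[OF *(3)] by (auto simp: t_def)
      moreover have "map (\<lambda>(a, c, b). [a, c]) t = padded_pair n u w"
        "map (\<lambda>(a, c, b). [c, b]) t = padded_pair n w v" "map (\<lambda>(a, c, b). [a, b]) t = s"
        by (simp_all add: t_def padded_pair_def *)
      ultimately show "s \<in> J"
        unfolding J_def K1_def K2_def using * by blast
    qed
  qed
  have alph: "convolution [u, v] \<in> lists (padded_alphabet \<Sigma> 2)" if "set u \<subseteq> \<Sigma>" "set v \<subseteq> \<Sigma>" for u v
    using at[OF that(1)] at[OF that(2)]
    by (simp add: convolution_pair padded_pair_def padded_alphabet_def B_def[symmetric] in_lists_conv_set image_iff)
  have "(?D \<inter> lists (padded_alphabet \<Sigma> 2 - {[None, None]})) \<inter> lists (padded_alphabet \<Sigma> 2) =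
      convolution ` {[u, v] | u v. \<exists>w. P u w \<and> Q w v}" (is "?l = ?r")
  proof
    show "?l \<subseteq> ?r"
    proof
      fix s assume "s \<in> ?l"
      then obtain k n u v w where *: "s @ replicate k [None, None] = padded_pair n u v"
        "[None, None] \<notin> set s" "P u w" "Q w v" "length u \<le> n" "length v \<le> n"
        unfolding J by (auto simp: in_lists_conv_set)
      then have "s = convolution [u, v]"
        using padded_pair_decompose by blast
      with * show "s \<in> ?r" by blast
    qed
    show "?r \<subseteq> ?l"
    proof
      fix s assume "s \<in> ?r"
      then obtain u v w where s: "s = convolution [u, v]" and *: "P u w" "Q w v" by blast
      \<comment> \<open>The common length must also cover the intermediate string \<open>w\<close>,
        which may outlast both \<open>u\<close> and \<open>v\<close>; the excess is what the
        quotient removes.\<close>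
      define n where "n = max (length w) (max (length u) (length v))"
      have n: "length u \<le> n" "length w \<le> n" "length v \<le> n" by (auto simp: n_def)
      have "length s \<le> n" by (simp add: s n_def convolution_pair padded_pair_def)
      then have "s @ replicate (n - length s) [None, None] = padded_pair n u v \<and> [None, None] \<notin> set s"
        by (subst padded_pair_decompose) (use n s in auto)
      moreover have "padded_pair n u v \<in> J" unfolding J using * n by blast
      moreover have "s \<in> lists (padded_alphabet \<Sigma> 2)"
        unfolding s using alph PS(1)[OF *(1)] QS(2)[OF *(2)] .
      ultimately show "s \<in> ?l" by (auto simp: in_lists_conv_set) metis
    qed
  qed
  with reg have "regular (padded_alphabet \<Sigma> 2) (convolution ` {[u, v] | u v. \<exists>w. P u w \<and> Q w v})"
    by simp
  moreover have "{[u, v] | u v. \<exists>w. P u w \<and> Q w v} \<subseteq> {ws. length ws = 2 \<and> set ws \<subseteq> lists \<Sigma>}"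
    using PS(1) QS(2) by (fastforce dest: subsetD)
  ultimately show ?thesis by (simp add: FA_recognizable_def)
qed

section \<open>Change of generators\<close>

text \<open>Induction over \<open>generate\<close>: the rules for the unit, a generator, an inverse
  of a generator and a product correspond to the diagonal, the hypothesis \<open>rec\<close>, the
  converse and the composition. The encoding \<nu> stays fixed throughout.\<close>

lemma FA_recognizable_generate:
  fixes G (structure)
  assumes "group G" and X: "X \<subseteq> carrier G" and R: "regular \<Sigma> R"
    and \<nu>: "bij_betw \<nu> R (carrier G)"
    and rec: "\<And>x. x \<in> X \<Longrightarrow>
      FA_recognizable \<Sigma> 2 {[u, v] | u v. u \<in> R \<and> v \<in> R \<and> \<nu> u \<otimes> x = \<nu> v}"
    and g: "g \<in> generate G X"
  shows "FA_recognizable \<Sigma> 2 {[u, v] | u v. u \<in> R \<and> v \<in> R \<and> \<nu> u \<otimes> g = \<nu> v}"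
proof -
  interpret group G by fact
  have carr: "\<nu> u \<in> carrier G" if "u \<in> R" for u
    using \<nu> that by (auto simp: bij_betw_def)
  have inj: "\<nu> u = \<nu> v \<longleftrightarrow> u = v" if "u \<in> R" "v \<in> R" for u v
    using \<nu> that by (auto simp: bij_betw_def inj_on_def)
  show ?thesis using g
  proof induction
    case one
    have "{[u, v] | u v. u \<in> R \<and> v \<in> R \<and> \<nu> u \<otimes> \<one> = \<nu> v} = {[u, u] | u. u \<in> R}"
      using carr inj by auto
    with FA_recognizable_diagonal[OF R] show ?case by simp
  next
    case (incl h)
    then show ?case by (rule rec)
  next
    case (inv h)
    have "u \<in> R \<and> v \<in> R \<and> \<nu> u \<otimes> inv h = \<nu> v \<longleftrightarrow> v \<in> R \<and> u \<in> R \<and> \<nu> v \<otimes> h = \<nu> u" for u v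
      using carr X inv by (metis inv_solve_right' subsetD)
    with FA_recognizable_converse[OF rec[OF inv]] show ?case by simp
  next
    case (eng h1 h2)
    have h: "h1 \<in> carrier G" "h2 \<in> carrier G"
      using eng.hyps generate_in_carrier[OF X] by auto
    have "u \<in> R \<and> v \<in> R \<and> \<nu> u \<otimes> (h1 \<otimes> h2) = \<nu> v \<longleftrightarrow>
      (\<exists>w. (u \<in> R \<and> w \<in> R \<and> \<nu> u \<otimes> h1 = \<nu> w) \<and> (w \<in> R \<and> v \<in> R \<and> \<nu> w \<otimes> h2 = \<nu> v))" for u v
    proof (cases "u \<in> R")
      case True
      \<comment> \<open>Surjectivity of \<nu> yields a string \<open>w\<close> for the intermediate
        element; associativity then splits the product at it.\<close>
      then have "\<nu> u \<otimes> h1 \<in> \<nu> ` R"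
        using \<nu> carr h by (simp add: bij_betw_def)
      then obtain w where "w \<in> R" "\<nu> u \<otimes> h1 = \<nu> w" by auto
      with True show ?thesis
        using carr h inj by (metis m_assoc)
    qed auto
    with FA_recognizable_relcomp[OF eng.IH] show ?case by simp
  qed
qed

theorem theorem6p9:
  fixes G :: "('g, 'b) monoid_scheme" and X Y :: "'g set"
  assumes "group G"
    and "finite_generating_set G X"
    and "graph_automatic G X"
    and "finite_generating_set G Y"
  shows "graph_automatic G Y"
proof -
  obtain \<Sigma> :: "nat set" and R \<nu> where *: "finite \<Sigma>" "regular \<Sigma> R" "bij_betw \<nu> R (carrier G)"
    "\<And>x. x \<in> X \<Longrightarrow> FA_recognizable \<Sigma> 2
       {[u, v] | u v. u \<in> R \<and> v \<in> R \<and> \<nu> u \<otimes>\<^bsub>G\<^esub> x = \<nu> v}"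
    using assms(3) unfolding graph_automatic_def by blast
  have X: "X \<subseteq> carrier G" "Y \<subseteq> generate G X"
    using assms(2,4) by (auto simp: finite_generating_set_def)
  \<comment> \<open>The same alphabet, language and bijection serve for \<open>Y\<close>, whose
    elements all lie in the group generated by \<open>X\<close>.\<close>
  show ?thesis
    unfolding graph_automatic_def
    by (intro exI conjI ballI, fact *(1), fact *(2), fact *(3),
        rule FA_recognizable_generate[OF assms(1) X(1) *(2,3)])
      (use * X in auto)
qed

end
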